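(* Suppose $\alpha=m/n$ with $m\in\mathbb{Z}$, $n\in\mathbb{Z}$, $0<|m|<n$ and $\gcd(|m|,n)=1$. Let $\kappa,\zeta,\varphi,\gamma\ge 0$ and $c>0$ with $\kappa\varphi=0$, and $\gamma>0$ if $\alpha<0$. Consider the Gaussian tempered stable convolution (GTSC) process, i.e. the spectrally negative Lévy process with Laplace exponent $$\psi(\theta)=(\theta-\varphi)\left[\kappa+\zeta\theta+c\Gamma(-\alpha)\left(\gamma^\alpha-(\gamma+\theta)^\alpha\right)\right].$$ Let $q\ge 0$, $m_+=\max(m,0)$ and $m_-=\max(-m,0)$. Then the polynomial $$f_q(z)=(z^n-\gamma-\varphi)\left[(\kappa-\zeta\gamma+c\Gamma(-\alpha)\gamma^\alpha)z^{m_-}+\zeta z^{n+m_-}-c\Gamma(-\alpha)z^{m_+}\right]-qz^{m_-}$$ has at least one real root. Let $\ell$ denote the number of distinct (complex) roots of $f_q$, let $r_1,\ldots,r_\ell$ be the roots, arranged such that $r_1$ is the largest real root, and let $\mu_1,\ldots,\mu_\ell$ be their multiplicities. Let $A_{kj}$, for $k=1,\ldots,\ell$ and $j=0,\ldots,\mu_k-1$, denote the coefficients in the partial fraction decomposition $$\frac{z^{m_-}}{f_q(z)}=\sum_{k=1}^{\ell}\sum_{j=0}^{\mu_k-1}\frac{A_{kj}}{(z-r_k)^{j+1}}.$$ Then $$\Phi(q)=r_1^n-\gamma$$ and, for $x>0$, $$W^{(q)}(x)=e^{-\gamma x}\sum_{k=1}^{\ell}\sum_{j=0}^{\mu_k-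1}A_{kj}\,\frac{1}{j!}\,x^{\frac{j+1}{n}-1}\,E^{(j)}_{\frac1n,\frac1n}\bigl(r_kx^{\frac1n}\bigr).$$
   Context: A spectrally negative Lévy process $X$ is a real-valued Lévy process with no positive jumps which is not the negative of a subordinator; its Laplace exponent is $\psi(\theta)=\log\mathbb{E}[e^{\theta X_1}]$, $\Re(\theta)\ge0$. For $q\ge 0$, $\Phi(q)=\sup\{\theta\ge 0:\psi(\theta)=q\}$. The $q$-scale function $W^{(q)}:\mathbb{R}\to[0,\infty)$ is zero on $(-\infty,0)$, continuous on $[0,\infty)$ (right continuous at the origin), and determined by $$\int_0^\infty e^{-\theta x}W^{(q)}(x)\,dx=\frac{1}{\psi(\theta)-q}\qquad\text{for }\Re(\theta)>\Phi(q).$$ $\Gamma$ is the gamma function as a meromorphic function, so $\Gamma(-\alpha)=-\alpha^{-1}\Gamma(1-\alpha)$, which is negative for $\alpha\in(0,1)$. The function $\psi$ in the claim is known to be the Laplace exponent of a spectrally negative Lévy process. $E_{a,b}(z)=\sum_{k\ge 0}\frac{z^k}{\Gamma(ak+b)}$ is the two-parameter Mittag-Leffler function ($a,b>0$), and $E^{(j)}_{a,b}$ denotes its $j$-th derivative in $z$. *)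

theory Defs
  imports "HOL-Probability.Probability" "HOL-Computational_Algebra.Polynomial"
begin

text \<open>A process is a family \<open>X t\<close> of real random variables on \<open>M\<close>; only the times \<open>t \<ge> 0\<close> matter.\<close>

definition levy_process :: "'a measure \<Rightarrow> (real \<Rightarrow> 'a \<Rightarrow> real) \<Rightarrow> bool" where
  "levy_process M X \<longleftrightarrow>
     prob_space M \<and>
     (\<forall>t\<ge>0. X t \<in> borel_measurable M) \<and>
     (AE \<omega> in M. X 0 \<omega> = 0) \<and>
     (\<forall>s t. 0 \<le> s \<longrightarrow> s \<le> t \<longrightarrow>
        distr M borel (\<lambda>\<omega>. X t \<omega> - X s \<omega>) = distr M borel (X (t - s))) \<and>
     (\<forall>(N::nat) (s::nat \<Rightarrow> real). 0 \<le> s 0 \<longrightarrow> mono s \<longrightarrow>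
        prob_space.indep_vars M (\<lambda>_. borel) (\<lambda>i \<omega>. X (s (Suc i)) \<omega> - X (s i) \<omega>) {..<N}) \<and>
     (AE \<omega> in M. \<forall>t\<ge>0. ((\<lambda>s. X s \<omega>) \<longlongrightarrow> X t \<omega>) (at_right t) \<and>
        (t > 0 \<longrightarrow> (\<exists>l. ((\<lambda>s. X s \<omega>) \<longlongrightarrow> l) (at_left t))))"

definition subordinator :: "'a measure \<Rightarrow> (real \<Rightarrow> 'a \<Rightarrow> real) \<Rightarrow> bool" where
  "subordinator M X \<longleftrightarrow>
     levy_process M X \<and> (AE \<omega> in M. mono_on {0..} (\<lambda>t. X t \<omega>))"

definition spectrally_negative_levy :: "'a measure \<Rightarrow> (real \<Rightarrow> 'a \<Rightarrow> real) \<Rightarrow> bool" where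
  "spectrally_negative_levy M X \<longleftrightarrow>
     levy_process M X \<and>
     (AE \<omega> in M. \<forall>t>0. \<forall>l. ((\<lambda>s. X s \<omega>) \<longlongrightarrow> l) (at_left t) \<longrightarrow> X t \<omega> \<le> l) \<and>
     \<not> subordinator M (\<lambda>t \<omega>. - X t \<omega>)"

text \<open>The logarithm in \<open>\<psi> \<theta> = log E[exp (\<theta> X\<^sub>1)]\<close> is the continuous branch on the closed right
  half-plane that vanishes at \<open>\<theta> = 0\<close>, so \<open>\<psi>\<close> is determined there; its values elsewhere are
  irrelevant.\<close>

definition has_laplace_exponent ::
    "'a measure \<Rightarrow> (real \<Rightarrow> 'a \<Rightarrow> real) \<Rightarrow> (complex \<Rightarrow> complex) \<Rightarrow> bool" where
  "has_laplace_exponent M X \<psi> \<longleftrightarrow>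
     \<psi> 0 = 0 \<and> continuous_on {\<theta>. Re \<theta> \<ge> 0} \<psi> \<and>
     (\<forall>\<theta>. Re \<theta> \<ge> 0 \<longrightarrow>
        integrable M (\<lambda>\<omega>. exp (\<theta> * complex_of_real (X 1 \<omega>))) \<and>
        exp (\<psi> \<theta>) = (LINT \<omega>|M. exp (\<theta> * complex_of_real (X 1 \<omega>))))"

definition Phi :: "(complex \<Rightarrow> complex) \<Rightarrow> real \<Rightarrow> real" where
  "Phi \<psi> q = Sup {\<theta>::real. \<theta> \<ge> 0 \<and> \<psi> (complex_of_real \<theta>) = complex_of_real q}"

definition is_scale_function :: "(complex \<Rightarrow> complex) \<Rightarrow> real \<Rightarrow> (real \<Rightarrow> real) \<Rightarrow> bool" where
  "is_scale_function \<psi> q W \<longleftrightarrow>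
     (\<forall>x. W x \<ge> 0) \<and> (\<forall>x<0. W x = 0) \<and> continuous_on {0..} W \<and>
     (\<forall>\<theta>. Re \<theta> > Phi \<psi> q \<longrightarrow>
        set_integrable lborel {0..} (\<lambda>x. exp (- \<theta> * complex_of_real x) * complex_of_real (W x)) \<and>
        (LINT x:{0..}|lborel. exp (- \<theta> * complex_of_real x) * complex_of_real (W x))
          = 1 / (\<psi> \<theta> - complex_of_real q))"

definition mittag_leffler :: "real \<Rightarrow> real \<Rightarrow> complex \<Rightarrow> complex" where
  "mittag_leffler a b z = (\<Sum>k. z ^ k / complex_of_real (Gamma (a * real k + b)))"

end

theory Submission imports Defs "HOL-Real_Asymp.Real_Asymp"
begin

text \<open>
  Substitute \<open>z = (\<gamma> + \<theta>)\<^bsup>1/n\<^esup>\<close>. Since \<open>\<alpha> = m/n\<close>, the power \<open>(\<gamma> + \<theta>)\<^bsup>\<alpha>\<^esup>\<close> becomes the integer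
  power \<open>z\<^bsup>m\<^esup>\<close>, and multiplying by \<open>z\<^bsup>m-\<^esup>\<close>, where \<open>m-\<close> is the negative part of \<open>m\<close>, clears
  negative exponents:
  \<open>f\<^sub>q(z) = z\<^bsup>m-\<^esup> (\<psi>(z\<^bsup>n\<^esup> - \<gamma>) - q)\<close> for real \<open>z \<ge> 0\<close> with \<open>z\<^bsup>n\<^esup> \<ge> \<gamma>\<close>
  (\<open>poly_gtsc_poly\<close>). Both remaining claims are read off from this identity.

  Location of the roots. On \<open>\<theta> \<ge> 0\<close> the exponent starts at \<open>\<psi>(0) = -\<kappa>\<phi> = 0 \<le> q\<close> and tends to infinity
  (\<open>gtsc_exponent_at_top\<close>, where the sign of \<open>\<Gamma>(-\<alpha>)\<close> enters). So \<open>f\<^sub>q\<close> changes sign to the right of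
  \<open>\<gamma>\<^bsup>1/n\<^esup>\<close>, its largest real root \<open>r\<^sub>1\<close> lies there, and because \<open>z \<mapsto> z\<^bsup>n\<^esup> - \<gamma>\<close> is increasing, the
  largest solution of \<open>\<psi>(\<theta>) = q\<close> is \<open>r\<^sub>1\<^bsup>n\<^esup> - \<gamma>\<close> (\<open>Sup_gtsc_exponent_level\<close>).

  The scale function. For large real \<open>\<theta>\<close> the identity gives
  \<open>1 / (\<psi>(\<theta>) - q) = z\<^bsup>m-\<^esup> / f\<^sub>q(z)\<close> at \<open>z = (\<gamma> + \<theta>)\<^bsup>1/n\<^esup>\<close>, a sum of partial fractions
  \<open>A\<^sub>k\<^sub>j / ((\<gamma> + \<theta>)\<^bsup>1/n\<^esup> - r\<^sub>k)\<^bsup>j+1\<^esup>\<close>. Each of these is the Laplace transform of a derivative of a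
  Mittag-Leffler function times a power (\<open>laplace_mittag_leffler\<close>), which is the termwise transform of
  a power series, and the shift by \<open>\<gamma>\<close> in the transform is the factor \<open>e\<^bsup>-\<gamma>x\<^esup>\<close>. Hence both sides of
  the asserted formula for \<open>W\<close> have the same Laplace transform near infinity. They are continuous on
  \<open>(0, \<infinity>)\<close>, so they agree there by Lerch's theorem (\<open>laplace_unique\<close>).
\<close>

section \<open>Higher derivatives of power series\<close>

lemma funpow_diffs:
  fixes c :: "nat \<Rightarrow> 'a::field_char_0"
  shows "(diffs ^^ j) c k = fact (k + j) / fact k * c (k + j)"
proof (induction j arbitrary: k)
  case (Suc j)
  have "(diffs ^^ Suc j) c k = of_nat (Suc k) * (fact (Suc k + j) / fact (Suc k) * c (Suc k + j))"
    by (simp add: diffs_def Suc.IH)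
  also have "\<dots> = fact (k + Suc j) / fact k * c (k + Suc j)"
    by (simp add: field_simps del: of_nat_Suc)
  finally show ?case .
qed simp

lemma summable_funpow_diffs:
  fixes c :: "nat \<Rightarrow> 'a::{real_normed_field,banach}"
  assumes "\<And>z. summable (\<lambda>k. c k * z ^ k)"
  shows "summable (\<lambda>k. (diffs ^^ j) c k * z ^ k)"
  using assms by (induction j arbitrary: z) (auto intro: termdiff_converges_all)

lemma higher_deriv_power_series:
  fixes c :: "nat \<Rightarrow> 'a::{real_normed_field,banach}"
  assumes "\<And>z. summable (\<lambda>k. c k * z ^ k)"
  shows "(deriv ^^ j) (\<lambda>z. \<Sum>k. c k * z ^ k) = (\<lambda>z. \<Sum>k. (diffs ^^ j) c k * z ^ k)"
proof (induction j)
  case (Suc j)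
  show ?case
  proof
    fix z :: 'a
    have "((\<lambda>z. \<Sum>k. (diffs ^^ j) c k * z ^ k) has_field_derivative
        (\<Sum>k. diffs ((diffs ^^ j) c) k * z ^ k)) (at z)"
      by (rule termdiffs_strong_converges_everywhere) (rule summable_funpow_diffs[OF assms])
    from DERIV_imp_deriv[OF this]
    show "(deriv ^^ Suc j) (\<lambda>z. \<Sum>k. c k * z ^ k) z = (\<Sum>k. (diffs ^^ Suc j) c k * z ^ k)"
      by (simp add: Suc.IH)
  qed
qed simp

lemma isCont_higher_deriv_power_series:
  fixes c :: "nat \<Rightarrow> 'a::{real_normed_field,banach}"
  assumes "\<And>z. summable (\<lambda>k. c k * z ^ k)"
  shows "isCont ((deriv ^^ j) (\<lambda>z. \<Sum>k. c k * z ^ k)) z"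
  unfolding higher_deriv_power_series[OF assms]
  by (rule DERIV_isCont, rule termdiffs_strong_converges_everywhere)
    (rule summable_funpow_diffs[OF assms])

text \<open>This is the \<open>j\<close>-th derivative of the geometric series, so it follows by differentiating
  termwise.\<close>

lemma negative_binomial_sums:
  fixes w :: "'a::{real_normed_field,banach}"
  assumes "norm w < 1"
  shows "(\<lambda>k. fact (k + j) / fact k * w ^ k) sums (fact j / (1 - w) ^ (j + 1))"
proof -
  have "(\<lambda>k. (diffs ^^ j) (\<lambda>_. 1) k * w ^ k) sums (fact j / (1 - w) ^ (j + 1))"
    using assms
  proof (induction j arbitrary: w)
    case 0
    then show ?case using geometric_sums[of w] by simp
  next
    case (Suc j)
    have "w \<noteq> 1" using Suc.prems by auto
    have "((\<lambda>w. fact j / (1 - w) ^ (j + 1)) has_field_derivative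
        fact (Suc j) / (1 - w) ^ (Suc j + 1)) (at w)"
      using \<open>w \<noteq> 1\<close>
      by (auto intro!: derivative_eq_intros simp: divide_simps) (cases j; simp add: algebra_simps)
    from termdiffs_sums_strong[of 1 "(diffs ^^ j) (\<lambda>_. 1)", OF Suc.IH this] Suc.prems
    show ?case by simp
  qed
  then show ?thesis by (simp add: funpow_diffs)
qed

section \<open>Mittag-Leffler functions\<close>

text \<open>The bound keeps only the part of the integral \<open>\<Gamma>(x) = \<integral> t\<^bsup>x-1\<^esup> e\<^bsup>-t\<^esup> dt\<close> over \<open>[T, T+1]\<close>. As \<open>T\<close> is
  arbitrary, \<open>\<Gamma>\<close> grows faster than every exponential, which makes the Mittag-Leffler functions
  entire.\<close>

lemma Gamma_lower_bound:
  fixes x T :: real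
  assumes "x \<ge> 1" "T > 0"
  shows "T powr (x - 1) * exp (- (T + 1)) \<le> Gamma x"
proof -
  have "ennreal (T powr (x - 1) * exp (- (T + 1))) =
      (\<integral>\<^sup>+t. ennreal (T powr (x - 1) * exp (- (T + 1))) * indicator {T..T+1} t \<partial>lborel)"
    by (simp add: nn_integral_cmult_indicator)
  also have "\<dots> \<le> (\<integral>\<^sup>+t. ennreal (indicator {0..} t * t powr (x - 1) / exp t) \<partial>lborel)"
  proof (intro nn_integral_mono)
    fix t :: real
    show "ennreal (T powr (x - 1) * exp (- (T + 1))) * indicator {T..T+1} t
        \<le> ennreal (indicator {0..} t * t powr (x - 1) / exp t)"
    proof (cases "t \<in> {T..T+1}")
      case True
      then have "T powr (x - 1) * exp (- (T + 1)) \<le> t powr (x - 1) * exp (- t)"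
        using assms by (intro mult_mono powr_mono2) auto
      then show ?thesis using True assms by (simp add: exp_minus field_simps)
    qed simp
  qed
  also have "\<dots> = ennreal (Gamma x)"
    using Gamma_conv_nn_integral_real[of x] assms by simp
  finally show ?thesis
    using Gamma_real_pos[of x] assms by (simp add: ennreal_le_iff)
qed

lemma summable_mittag_leffler:
  fixes z :: complex
  assumes "a > 0" "b > 0"
  shows "summable (\<lambda>k. 1 / complex_of_real (Gamma (a * real k + b)) * z ^ k)"
proof -
  \<comment> \<open>With \<open>T\<^bsup>a\<^esup> = B\<close> the lower bound for \<open>\<Gamma>(ak + b)\<close> has ratio \<open>B\<close>, so the terms decay
    at least like \<open>(norm z / B)\<^bsup>k\<^esup> \<le> (1/2)\<^bsup>k\<^esup>\<close>.\<close>
  define B where "B = 2 * (norm z + 1)"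
  define T where "T = B powr (1 / a)"
  define C where "C = exp (T + 1) * T powr (1 - b)"
  have "B > 0" by (simp add: B_def add_nonneg_pos)
  then have "T > 0" and Ta: "T powr a = B" using assms by (simp_all add: T_def powr_powr)
  have "eventually (\<lambda>k. norm (1 / complex_of_real (Gamma (a * real k + b)) * z ^ k)
      \<le> C * (1/2) ^ k) sequentially"
    using eventually_ge_at_top[of "nat \<lceil>1 / a\<rceil>"]
  proof eventually_elim
    case (elim k)
    have "1 / a \<le> real k" using elim by linarith
    then have ge1: "a * real k + b \<ge> 1" using assms by (simp add: field_simps)
    have pos: "Gamma (a * real k + b) > 0" using ge1 by (intro Gamma_real_pos) simp
    have "T powr (a * real k + b - 1) = B ^ k * T powr (b - 1)"
      using \<open>B > 0\<close> Ta by (simp add: powr_add powr_realpow flip: powr_powr add_diff_eq)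
    with Gamma_lower_bound[OF ge1 \<open>T > 0\<close>]
    have "B ^ k * T powr (b - 1) * exp (- (T + 1)) \<le> Gamma (a * real k + b)" by simp
    then have "1 / Gamma (a * real k + b) \<le> 1 / (B ^ k * T powr (b - 1) * exp (- (T + 1)))"
      using \<open>B > 0\<close> \<open>T > 0\<close> pos by (intro divide_left_mono) auto
    also have "\<dots> = C * (1 / B) ^ k"
      unfolding C_def powr_diff exp_minus
      using \<open>T > 0\<close> by (simp add: power_divide field_simps)
    finally have "1 / Gamma (a * real k + b) * norm z ^ k \<le> C * (1 / B) ^ k * norm z ^ k"
      by (rule mult_right_mono) simp
    also have "\<dots> = C * (norm z / B) ^ k" by (simp add: power_divide)
    also have "\<dots> \<le> C * (1/2) ^ k"
      using \<open>T > 0\<close> \<open>B > 0\<close> by (intro mult_left_mono power_mono) (auto simp: C_def B_def field_simps)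
    finally show ?case using pos by (simp add: norm_mult norm_divide norm_power)
  qed
  then show ?thesis
    by (rule summable_comparison_test_ev) (intro summable_mult summable_geometric, simp)
qed

lemma mittag_leffler_power_series:
  "mittag_leffler a b = (\<lambda>z. \<Sum>k. 1 / complex_of_real (Gamma (a * real k + b)) * z ^ k)"
  by (simp add: mittag_leffler_def fun_eq_iff)

lemma higher_deriv_mittag_leffler_sums:
  assumes "a > 0" "b > 0"
  shows "(\<lambda>k. fact (k + j) / fact k / complex_of_real (Gamma (a * real (k + j) + b)) * z ^ k)
     sums (deriv ^^ j) (mittag_leffler a b) z"
  using summable_sums[OF summable_funpow_diffs[OF summable_mittag_leffler[OF assms]], of j z]
  unfolding mittag_leffler_power_series
    higher_deriv_power_series[OF summable_mittag_leffler[OF assms]] funpow_diffs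
  by simp

lemma isCont_higher_deriv_mittag_leffler:
  assumes "a > 0" "b > 0"
  shows "isCont ((deriv ^^ j) (mittag_leffler a b)) z"
  unfolding mittag_leffler_power_series
  by (rule isCont_higher_deriv_power_series[OF summable_mittag_leffler[OF assms]])

section \<open>Laplace transforms of Mittag-Leffler kernels\<close>

text \<open>Substituting \<open>t = s x\<close> turns the Gamma integral into this transform. The integrand is
  nonnegative, so integrability and value come together from the nonnegative integral. The point
  \<open>0\<close>, where the powers may be singular, is excluded throughout; it is a null set.\<close>

lemma laplace_powr:
  fixes b s :: real
  assumes "b > 0" "s > 0"
  shows "has_bochner_integral lborel
    (\<lambda>x. indicator {0<..} x *\<^sub>R (exp (- (s * x)) * x powr (b - 1))) (Gamma b * s powr (- b))"
proof (rule has_bochner_integral_nn_integral)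
  let ?f = "\<lambda>t::real. indicator {0..} t * t powr (b - 1) / exp t"
  let ?g = "\<lambda>x::real. indicator {0<..} x *\<^sub>R (exp (- (s * x)) * x powr (b - 1))"
  have "ennreal (Gamma b) = (\<integral>\<^sup>+t. ennreal (?f t) \<partial>lborel)"
    by (rule Gamma_conv_nn_integral_real[OF assms(1)])
  also have "\<dots> = ennreal s * (\<integral>\<^sup>+x. ennreal (?f (0 + s * x)) \<partial>lborel)"
    using assms by (subst nn_integral_real_affine[where c = s and t = 0]) auto
  also have "(\<integral>\<^sup>+x. ennreal (?f (0 + s * x)) \<partial>lborel)
      = (\<integral>\<^sup>+x. ennreal (s powr (b - 1)) * ennreal (?g x) \<partial>lborel)"
    using assms
    by (intro nn_integral_cong_AE eventually_mono[OF AE_lborel_singleton[of 0]])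
      (auto simp: indicator_def powr_mult exp_minus field_simps zero_le_mult_iff
        simp flip: ennreal_mult)
  also have "\<dots> = ennreal (s powr (b - 1)) * (\<integral>\<^sup>+x. ennreal (?g x) \<partial>lborel)"
    by (rule nn_integral_cmult) measurable
  also have "ennreal s * (ennreal (s powr (b - 1)) * (\<integral>\<^sup>+x. ennreal (?g x) \<partial>lborel))
      = ennreal (s powr b) * (\<integral>\<^sup>+x. ennreal (?g x) \<partial>lborel)"
    using assms by (simp add: powr_diff flip: mult.assoc ennreal_mult)
  finally have eq: "ennreal (Gamma b) = ennreal (s powr b) * (\<integral>\<^sup>+x. ennreal (?g x) \<partial>lborel)" .
  have "ennreal (Gamma b * s powr (- b)) = ennreal (s powr (- b)) * ennreal (Gamma b)"
    using assms by (subst ennreal_mult'' [symmetric]) (simp_all add: Gamma_real_pos less_imp_le mult.commute)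
  also have "\<dots> = ennreal (s powr (- b) * s powr b) * (\<integral>\<^sup>+x. ennreal (?g x) \<partial>lborel)"
    unfolding eq by (simp add: ennreal_mult mult.assoc)
  also have "s powr (- b) * s powr b = 1" using assms by (simp flip: powr_add)
  finally show "(\<integral>\<^sup>+x. ennreal (?g x) \<partial>lborel) = ennreal (Gamma b * s powr (- b))" by simp
qed (use assms in \<open>auto simp: Gamma_real_pos less_imp_le\<close>)

text \<open>The kernel is a power series \<open>\<Sum>k. C\<^sub>k x\<^bsup>a(k+j)+b-1\<^esup>\<close> with
  \<open>C\<^sub>k = (k+j)!/k! r\<^bsup>k\<^esup> / \<Gamma>(a(k+j)+b)\<close>. Transforming one term cancels the Gamma value and leaves
  \<open>s\<^bsup>-b\<^esup> p\<^bsup>-j\<^esup> (k+j)!/k! (r/p)\<^bsup>k\<^esup>\<close> with \<open>p = s\<^bsup>a\<^esup>\<close>, and these sum to the right-hand side by the negative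
  binomial series. The same series at \<open>norm r / p < 1\<close> bounds the integrals of the norms, which
  justifies the exchange of sum and integral.\<close>

lemma laplace_mittag_leffler:
  fixes a b s :: real and r :: complex
  assumes "a > 0" "b > 0" "s > 0" "norm r < s powr a"
  shows "has_bochner_integral lborel
    (\<lambda>x. indicator {0<..} x *\<^sub>R (of_real (exp (- (s * x))) * (of_real (x powr (a * real j + b - 1)) *
        (deriv ^^ j) (mittag_leffler a b) (r * of_real (x powr a)))))
    (fact j * of_real (s powr (a - b)) / (of_real (s powr a) - r) ^ (j + 1))"
proof -
  define p where "p = s powr a"
  have "p > 0" using assms by (simp add: p_def)
  define B where "B = (\<lambda>k. a * real (k + j) + b)"
  have B: "B k > 0" for k using assms by (simp add: B_def add_nonneg_pos)
  have GB: "Gamma (B k) > 0" for k using B by (rule Gamma_real_pos)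
  define C :: "nat \<Rightarrow> complex" where
    "C = (\<lambda>k. fact (k + j) / fact k * r ^ k / of_real (Gamma (B k)))"
  define g :: "nat \<Rightarrow> real \<Rightarrow> real" where
    "g = (\<lambda>k x. indicator {0<..} x *\<^sub>R (exp (- (s * x)) * x powr (B k - 1)))"
  define f :: "nat \<Rightarrow> real \<Rightarrow> complex" where "f = (\<lambda>k x. C k * of_real (g k x))"
  have g: "has_bochner_integral lborel (g k) (Gamma (B k) * s powr (- B k))" for k
    unfolding g_def using B assms(3) by (rule laplace_powr)
  have f: "has_bochner_integral lborel (f k) (C k * of_real (Gamma (B k) * s powr (- B k)))" for k
    unfolding f_def by (intro has_bochner_integral_mult_right has_bochner_integral_of_real g)
  have g_nonneg: "g k x \<ge> 0" for k x by (simp add: g_def)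
  have sB: "s powr (- B k) = s powr (- b) * (1 / p) ^ j * (1 / p) ^ k" for k
  proof -
    have "p ^ (k + j) = s powr (a * real (k + j))"
      using \<open>p > 0\<close> unfolding p_def by (simp add: powr_powr flip: powr_realpow)
    then have "s powr B k = p ^ (k + j) * s powr b" by (simp add: B_def powr_add)
    then show ?thesis by (simp add: powr_minus power_add power_divide divide_simps)
  qed
  have val: "C k * of_real (Gamma (B k) * s powr (- B k))
      = of_real (s powr (- b) * (1 / p) ^ j) * (fact (k + j) / fact k * (r / of_real p) ^ k)" for k
    using GB[of k] unfolding sB C_def by (simp add: power_divide field_simps)
  have nval: "(\<integral>x. norm (f k x) \<partial>lborel)
      = s powr (- b) * (1 / p) ^ j * (fact (k + j) / fact k * (norm r / p) ^ k)" for k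
  proof -
    have "(\<integral>x. norm (f k x) \<partial>lborel) = (\<integral>x. norm (C k) * g k x \<partial>lborel)"
      by (simp add: f_def norm_mult g_nonneg)
    also have "\<dots> = norm (C k) * (Gamma (B k) * s powr (- B k))"
      using has_bochner_integral_integral_eq[OF g[of k]] by simp
    also have "\<dots> = s powr (- b) * (1 / p) ^ j * (fact (k + j) / fact k * (norm r / p) ^ k)"
      using GB[of k] unfolding sB C_def
      by (simp add: norm_mult norm_divide norm_power power_divide field_simps)
    finally show ?thesis .
  qed
  have x_powr: "x powr (B k - 1) = x powr (a * real j + b - 1) * (x powr a) ^ k" if "x > 0" for x k
    using that by (simp add: B_def powr_powr powr_add[symmetric] algebra_simps flip: powr_realpow)
  have lt: "norm r / p < 1" using assms \<open>p > 0\<close> by (simp add: p_def)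
  have pt: "(\<lambda>k. f k x) sums (indicator {0<..} x *\<^sub>R (of_real (exp (- (s * x))) *
      (of_real (x powr (a * real j + b - 1)) *
        (deriv ^^ j) (mittag_leffler a b) (r * of_real (x powr a)))))" for x
  proof (cases "x > 0")
    case True
    have "f k x = of_real (exp (- (s * x))) * (of_real (x powr (a * real j + b - 1)) *
        (fact (k + j) / fact k / complex_of_real (Gamma (a * real (k + j) + b))
          * (r * of_real (x powr a)) ^ k))" for k
      using True x_powr[of x k] by (simp add: f_def C_def g_def B_def power_mult_distrib)
    moreover have "(\<lambda>k. of_real (exp (- (s * x))) * (of_real (x powr (a * real j + b - 1)) *
        (fact (k + j) / fact k / complex_of_real (Gamma (a * real (k + j) + b))
          * (r * of_real (x powr a)) ^ k))) sums (of_real (exp (- (s * x))) *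
      (of_real (x powr (a * real j + b - 1)) *
        (deriv ^^ j) (mittag_leffler a b) (r * of_real (x powr a))))"
      by (intro sums_mult higher_deriv_mittag_leffler_sums assms)
    ultimately show ?thesis using True by simp
  next
    case False
    then show ?thesis by (simp add: f_def g_def)
  qed
  have summ: "summable (\<lambda>k. norm (f k x))" for x
  proof -
    have "summable (\<lambda>k. norm ((diffs ^^ j) (\<lambda>k. 1 / complex_of_real (Gamma (a * real k + b))) k
        * (r * of_real (x powr a)) ^ k))"
      by (rule powser_insidea[where x = "of_real (norm (r * of_real (x powr a)) + 1)"],
          rule summable_funpow_diffs[OF summable_mittag_leffler[OF assms(1,2)]])
        (simp del: of_real_add)
    then have "summable (\<lambda>k. norm (of_real (exp (- (s * x))) * of_real (x powr (a * real j + b - 1)) :: complex) *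
         norm ((diffs ^^ j) (\<lambda>k. 1 / complex_of_real (Gamma (a * real k + b))) k
        * (r * of_real (x powr a)) ^ k))"
      by (rule summable_mult)
    moreover have "norm (of_real (exp (- (s * x))) * of_real (x powr (a * real j + b - 1)) :: complex) *
         norm ((diffs ^^ j) (\<lambda>k. 1 / complex_of_real (Gamma (a * real k + b))) k
        * (r * of_real (x powr a)) ^ k) = norm (f k x)" if "x > 0" for k
      using that x_powr[of x k]
      by (simp add: f_def C_def g_def B_def power_mult_distrib norm_mult norm_divide norm_power
          funpow_diffs)
    ultimately show ?thesis by (cases "x > 0") (simp_all add: f_def g_def)
  qed
  have summI: "summable (\<lambda>k. \<integral>x. norm (f k x) \<partial>lborel)"
    unfolding nval using negative_binomial_sums[of "norm r / p" j] lt \<open>p > 0\<close>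
    by (intro summable_mult) (auto simp: sums_iff)
  note int = integrable.intros[OF f]
  have I: "integrable lborel (\<lambda>x. \<Sum>k. f k x)"
    by (rule integrable_suminf[OF int _ summI]) (simp add: summ)
  have "(\<lambda>k. integral\<^sup>L lborel (f k)) sums (\<integral>x. (\<Sum>k. f k x) \<partial>lborel)"
    by (rule sums_integral[OF int _ summI]) (simp add: summ)
  moreover have "(\<lambda>k. integral\<^sup>L lborel (f k)) sums
      (of_real (s powr (- b) * (1 / p) ^ j) * (fact j / (1 - r / of_real p) ^ (j + 1)))"
    unfolding has_bochner_integral_integral_eq[OF f] val
    using lt \<open>p > 0\<close> by (intro sums_mult negative_binomial_sums) (simp add: norm_divide)
  ultimately have "(\<integral>x. (\<Sum>k. f k x) \<partial>lborel)
      = of_real (s powr (- b) * (1 / p) ^ j) * (fact j / (1 - r / of_real p) ^ (j + 1))"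
    by (rule sums_unique2)
  also have "\<dots> = fact j * of_real (s powr (a - b)) / (of_real p - r) ^ (j + 1)"
  proof -
    have "r \<noteq> of_real p" using lt \<open>p > 0\<close> by auto
    have "1 - r / of_real p = (of_real p - r) / of_real p" using \<open>p > 0\<close> by (simp add: diff_divide_distrib)
    moreover have "s powr (a - b) = s powr (- b) * p"
      using \<open>s > 0\<close> by (simp add: p_def flip: powr_add)
    ultimately show ?thesis
      using \<open>p > 0\<close> \<open>r \<noteq> of_real p\<close> by (simp add: power_divide field_simps)
  qed
  finally show ?thesis
    using I sums_unique[OF pt] by (simp add: has_bochner_integral_iff p_def)
qed

section \<open>Uniqueness of the Laplace transform\<close>

text \<open>Under \<open>u = e\<^bsup>-x\<^esup>\<close> the hypothesis says that all moments vanish, hence \<open>g\<close> is orthogonal to every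
  polynomial in \<open>e\<^bsup>-x\<^esup>\<close>, and by Weierstrass approximation on \<open>[0, 1]\<close> to every continuous function of
  \<open>e\<^bsup>-x\<^esup>\<close>. If \<open>g\<close> were positive at \<open>x\<^sub>0\<close>, it would be positive near \<open>x\<^sub>0\<close>, and a bump function \<open>\<phi>\<close>
  supported there would give a positive integral.\<close>

lemma laplace_zero_not_pos:
  fixes g :: "real \<Rightarrow> real"
  assumes cont: "continuous_on {0<..} g"
    and int: "integrable lborel (\<lambda>x. indicator {0<..} x *\<^sub>R g x)"
    and zero: "\<And>k::nat. (\<integral>x. exp (- (real k * x)) * (indicator {0<..} x *\<^sub>R g x) \<partial>lborel) = 0"
    and "x0 > 0"
  shows "\<not> g x0 > 0"
proof
  assume pos: "g x0 > 0"
  define h where "h = (\<lambda>x. indicator {0<..} x *\<^sub>R g x)"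
  have h: "integrable lborel h" using int by (simp add: h_def)
  then have [measurable]: "h \<in> borel_measurable borel" by simp
  have "isCont g x0" using cont \<open>x0 > 0\<close> by (simp add: continuous_on_eq_continuous_at)
  then have "eventually (\<lambda>x. g x > 0) (at x0)"
    using pos by (simp add: isCont_def order_tendsto_iff)
  then obtain d0 where d0: "d0 > 0" "\<And>x. x \<noteq> x0 \<Longrightarrow> dist x x0 < d0 \<Longrightarrow> g x > 0"
    by (auto simp: eventually_at)
  define d where "d = min d0 x0"
  have d: "d > 0" "d \<le> x0" using d0 \<open>x0 > 0\<close> by (auto simp: d_def)
  have gpos: "g x > 0" if "\<bar>x - x0\<bar> < d" for x
    using d0(2)[of x] that pos by (cases "x = x0") (auto simp: d_def dist_real_def)
  \<comment> \<open>A bump in the variable \<open>u = e\<^bsup>-x\<^esup>\<close>, positive exactly for \<open>x\<close> within \<open>d\<close> of \<open>x\<^sub>0\<close>.\<close>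
  define \<phi> :: "real \<Rightarrow> real" where
    "\<phi> = (\<lambda>u. max 0 ((u - exp (- (x0 + d))) * (exp (- (x0 - d)) - u)))"
  have \<phi>cont: "continuous_on A \<phi>" for A unfolding \<phi>_def by (intro continuous_intros)
  then have [measurable]: "\<phi> \<in> borel_measurable borel"
    by (rule borel_measurable_continuous_onI)
  have \<phi>pos: "\<phi> (exp (- x)) > 0 \<longleftrightarrow> \<bar>x - x0\<bar> < d" for x
    using d by (auto simp: \<phi>_def less_max_iff_disj zero_less_mult_iff abs_less_iff)
  have \<phi>nn: "\<phi> u \<ge> 0" for u by (simp add: \<phi>_def)
  have bdd: "bounded (\<phi> ` {0..1})"
    by (intro compact_imp_bounded compact_continuous_image \<phi>cont) auto
  then obtain B where "\<forall>y\<in>\<phi> ` {0..1}. norm y \<le> B"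
    unfolding bounded_iff by blast
  then have B: "\<bar>\<phi> u\<bar> \<le> B" if "u \<in> {0..1}" for u using that by simp
  have \<phi>h: "integrable lborel (\<lambda>x. \<phi> (exp (- x)) * h x)"
  proof (rule Bochner_Integration.integrable_bound)
    show "integrable lborel (\<lambda>x. B * h x)" using h by simp
    show "AE x in lborel. norm (\<phi> (exp (- x)) * h x) \<le> norm (B * h x)"
    proof (intro AE_I2)
      fix x :: real
      show "norm (\<phi> (exp (- x)) * h x) \<le> norm (B * h x)"
      proof (cases "x > 0")
        case True
        then have "\<bar>\<phi> (exp (- x))\<bar> \<le> \<bar>B\<bar>" using B[of "exp (- x)"] by simp
        then show ?thesis by (simp add: abs_mult mult_right_mono)
      qed (simp add: h_def)
    qed
  qed measurable
  have "\<bar>\<integral>x. \<phi> (exp (- x)) * h x \<partial>lborel\<bar> \<le> e * (\<integral>x. \<bar>h x\<bar> \<partial>lborel)" if "e > 0" for e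
  proof -
    obtain p where "real_polynomial_function p"
      and p: "\<And>u. u \<in> {0..1} \<Longrightarrow> \<bar>\<phi> u - p u\<bar> < e"
      using Stone_Weierstrass_real_polynomial_function[OF compact_Icc \<phi>cont \<open>e > 0\<close>, of 0 1] by blast
    then obtain c n where c: "p = (\<lambda>u. \<Sum>i\<le>n. c i * u ^ i)"
      by (auto simp: real_polynomial_function_iff_sum)
    have hk: "integrable lborel (\<lambda>x. exp (- (real k * x)) * h x)" for k :: nat
    proof (rule Bochner_Integration.integrable_bound[OF h])
      show "AE x in lborel. norm (exp (- (real k * x)) * h x) \<le> norm (h x)"
      proof (intro AE_I2)
        fix x :: real
        show "norm (exp (- (real k * x)) * h x) \<le> norm (h x)"
          by (cases "x > 0") (auto simp: h_def abs_mult intro!: mult_left_le_one_le)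
      qed
    qed measurable
    have pexp: "p (exp (- x)) * h x = (\<Sum>i\<le>n. c i * (exp (- (real i * x)) * h x))" for x
      by (simp add: c sum_distrib_right exp_of_nat_mult[symmetric] mult.assoc)
    have pI: "integrable lborel (\<lambda>x. p (exp (- x)) * h x)"
      unfolding pexp by (intro Bochner_Integration.integrable_sum integrable_mult_right hk)
    have "(\<integral>x. p (exp (- x)) * h x \<partial>lborel) = (\<Sum>i\<le>n. c i * (\<integral>x. exp (- (real i * x)) * h x \<partial>lborel))"
      unfolding pexp using hk by (subst Bochner_Integration.integral_sum) auto
    also have "\<dots> = 0" using zero by (simp add: h_def)
    finally have "(\<integral>x. \<phi> (exp (- x)) * h x \<partial>lborel)
        = (\<integral>x. \<phi> (exp (- x)) * h x - p (exp (- x)) * h x \<partial>lborel)"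
      using \<phi>h pI by simp
    also have "\<bar>\<dots>\<bar> \<le> (\<integral>x. \<bar>\<phi> (exp (- x)) * h x - p (exp (- x)) * h x\<bar> \<partial>lborel)"
      by (rule integral_abs_bound)
    also have "\<dots> \<le> (\<integral>x. e * \<bar>h x\<bar> \<partial>lborel)"
    proof (rule integral_mono)
      show "\<bar>\<phi> (exp (- x)) * h x - p (exp (- x)) * h x\<bar> \<le> e * \<bar>h x\<bar>" for x
      proof (cases "x > 0")
        case True
        then have "\<bar>\<phi> (exp (- x)) - p (exp (- x))\<bar> \<le> e" using p[of "exp (- x)"] by simp
        then show ?thesis by (simp add: abs_mult mult_right_mono flip: left_diff_distrib)
      qed (simp add: h_def)
    qed (use \<phi>h pI h in auto)
    finally show ?thesis by simp
  qed
  then have "\<bar>\<integral>x. \<phi> (exp (- x)) * h x \<partial>lborel\<bar> \<le> (\<integral>x. \<bar>h x\<bar> \<partial>lborel) * e" if "e > 0" for e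
    using that by (simp add: mult.commute)
  moreover have "((\<lambda>e. (\<integral>x. \<bar>h x\<bar> \<partial>lborel) * e) \<longlongrightarrow> (\<integral>x. \<bar>h x\<bar> \<partial>lborel) * 0) (at_right 0)"
    by (intro tendsto_intros)
  ultimately have "\<bar>\<integral>x. \<phi> (exp (- x)) * h x \<partial>lborel\<bar> \<le> 0"
    by (intro tendsto_lowerbound[where F = "at_right (0::real)"])
      (auto simp: eventually_at_right_less elim: eventually_mono[OF eventually_at_right_less])
  then have "(\<integral>x. \<phi> (exp (- x)) * h x \<partial>lborel) = 0" by simp
  moreover have "\<phi> (exp (- x)) * h x \<ge> 0" for x
    using \<phi>pos[of x] \<phi>nn[of "exp (- x)"] gpos[of x]
    by (cases "\<bar>x - x0\<bar> < d") (auto simp: h_def indicator_def order.order_iff_strict)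
  ultimately have "AE x in lborel. \<phi> (exp (- x)) * h x = 0"
    using integral_nonneg_eq_0_iff_AE[OF \<phi>h] by simp
  then have "AE x in lborel. x \<notin> {x0 - d<..<x0 + d}"
  proof eventually_elim
    case (elim x)
    show ?case
    proof
      assume "x \<in> {x0 - d<..<x0 + d}"
      then have "\<bar>x - x0\<bar> < d" and "x > 0" using d by auto
      then show False using elim \<phi>pos[of x] gpos[of x] by (simp add: h_def)
    qed
  qed
  then have "{x0 - d<..<x0 + d} \<in> null_sets lborel"
    by (subst AE_iff_null_sets) auto
  then show False using d by (simp add: null_sets_def)
qed

text \<open>Damping by \<open>e\<^bsup>-(\<sigma>+1)x\<^esup>\<close> moves the transform into its region of convergence, where its values at
  the integers \<open>k \<ge> 0\<close> are the vanishing moments needed above; applying this to both \<open>g\<close> and \<open>-g\<close>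
  leaves only zero.\<close>

lemma laplace_unique_real:
  fixes g :: "real \<Rightarrow> real"
  assumes cont: "continuous_on {0<..} g"
    and lap: "\<And>s. s > \<sigma> \<Longrightarrow> has_bochner_integral lborel
      (\<lambda>x. indicator {0<..} x *\<^sub>R (exp (- (s * x)) * g x)) 0"
    and "x > 0"
  shows "g x = 0"
proof -
  define g' where "g' = (\<lambda>x. exp (- ((\<sigma> + 1) * x)) * g x)"
  have c: "continuous_on {0<..} g'" unfolding g'_def by (intro continuous_intros cont)
  have i: "integrable lborel (\<lambda>x. indicator {0<..} x *\<^sub>R g' x)"
    using lap[of "\<sigma> + 1"] unfolding g'_def by (simp add: has_bochner_integral_iff)
  have z: "(\<integral>x. exp (- (real k * x)) * (indicator {0<..} x *\<^sub>R g' x) \<partial>lborel) = 0" for k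
  proof -
    have "(\<lambda>x. exp (- (real k * x)) * (indicator {0<..} x *\<^sub>R g' x))
        = (\<lambda>x. indicator {0<..} x *\<^sub>R (exp (- ((\<sigma> + 1 + real k) * x)) * g x))"
      by (simp add: g'_def fun_eq_iff algebra_simps flip: exp_add)
    then show ?thesis
      using has_bochner_integral_integral_eq[OF lap[of "\<sigma> + 1 + real k"]] by simp
  qed
  have "\<not> g' x > 0" by (rule laplace_zero_not_pos[OF c i z \<open>x > 0\<close>])
  moreover have "\<not> - g' x > 0"
    by (rule laplace_zero_not_pos[where g = "\<lambda>x. - g' x"]) (use c i z \<open>x > 0\<close> in \<open>auto intro: continuous_intros\<close>)
  ultimately have "g' x = 0" by linarith
  then show ?thesis by (simp add: g'_def)
qed

text \<open>Lerch's theorem for continuous functions; real and imaginary part of the difference are treated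
  separately. Agreement at all large real \<open>s\<close> already suffices.\<close>

lemma laplace_unique:
  fixes f g :: "real \<Rightarrow> complex"
  assumes "continuous_on {0<..} f" "continuous_on {0<..} g"
    and f: "\<And>s. s > \<sigma> \<Longrightarrow> has_bochner_integral lborel
      (\<lambda>x. indicator {0<..} x *\<^sub>R (of_real (exp (- (s * x))) * f x)) (L s)"
    and g: "\<And>s. s > \<sigma> \<Longrightarrow> has_bochner_integral lborel
      (\<lambda>x. indicator {0<..} x *\<^sub>R (of_real (exp (- (s * x))) * g x)) (L s)"
    and "x > 0"
  shows "f x = g x"
proof -
  have d: "has_bochner_integral lborel
      (\<lambda>x. indicator {0<..} x *\<^sub>R (of_real (exp (- (s * x))) * (f x - g x))) 0" if "s > \<sigma>" for s
    using has_bochner_integral_diff[OF f[OF that] g[OF that]] by (simp add: algebra_simps)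
  have "Re (f x - g x) = 0"
    by (rule laplace_unique_real[where g = "\<lambda>x. Re (f x - g x)" and \<sigma> = \<sigma>])
      (use assms has_bochner_integral_bounded_linear[OF bounded_linear_Re d]
        in \<open>auto intro!: continuous_intros simp del: minus_complex.sel\<close>)
  moreover have "Im (f x - g x) = 0"
    by (rule laplace_unique_real[where g = "\<lambda>x. Im (f x - g x)" and \<sigma> = \<sigma>])
      (use assms has_bochner_integral_bounded_linear[OF bounded_linear_Im d]
        in \<open>auto intro!: continuous_intros simp del: minus_complex.sel\<close>)
  ultimately show ?thesis by (simp add: complex_eq_iff)
qed

section \<open>The exponent and its polynomial\<close>

text \<open>The restriction of \<open>\<psi>\<close> to real arguments \<open>\<theta> \<ge> 0\<close>, which determines both \<open>\<Phi>(q)\<close> and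
  \<open>W\<^bsup>(q)\<^esup>\<close>.\<close>

definition gtsc_exponent :: "real \<Rightarrow> real \<Rightarrow> real \<Rightarrow> real \<Rightarrow> real \<Rightarrow> real \<Rightarrow> real \<Rightarrow> real" where
  "gtsc_exponent \<alpha> \<kappa> \<zeta> \<phi> \<gamma> c \<theta> = (\<theta> - \<phi>) * (\<kappa> + \<zeta> * \<theta> + c * Gamma (- \<alpha>) * (\<gamma> powr \<alpha> - (\<gamma> + \<theta>) powr \<alpha>))"

text \<open>The polynomial \<open>f\<^sub>q\<close>. Here \<open>mp\<close> and \<open>mm\<close> stand for the positive and negative part of \<open>m = \<alpha>n\<close>.\<close>

definition gtsc_poly :: "nat \<Rightarrow> nat \<Rightarrow> nat \<Rightarrow> real \<Rightarrow> real \<Rightarrow> real \<Rightarrow> real \<Rightarrow> real \<Rightarrow> real \<Rightarrow> real \<Rightarrow> real poly" where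
  "gtsc_poly n mp mm \<alpha> \<kappa> \<zeta> \<phi> \<gamma> c q = (monom 1 n - [:\<gamma>:] - [:\<phi>:]) *
     (monom (\<kappa> - \<zeta> * \<gamma> + c * Gamma (- \<alpha>) * \<gamma> powr \<alpha>) mm + monom \<zeta> (n + mm)
       - monom (c * Gamma (- \<alpha>)) mp) - monom q mm"

text \<open>With \<open>z\<^bsup>n\<^esup> = \<gamma> + \<theta>\<close> this reduces to \<open>z\<^bsup>m+\<^esup> = z\<^bsup>m-\<^esup> (z\<^bsup>n\<^esup>)\<^bsup>\<alpha>\<^esup>\<close>, where \<open>m+\<close> and \<open>m-\<close>
  are the positive and negative part of \<open>m\<close>. At \<open>z = 0\<close> both sides of that equation vanish, since
  \<open>\<gamma> \<le> z\<^bsup>n\<^esup> = 0\<close> forces \<open>\<alpha> > 0\<close>.\<close>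

lemma poly_gtsc_poly:
  fixes m :: int and n :: nat
  assumes \<alpha>: "\<alpha> = real_of_int m / real n" and "m \<noteq> 0" "n > 0"
    and \<gamma>: "\<alpha> < 0 \<Longrightarrow> \<gamma> > 0" and "z \<ge> 0" "z ^ n \<ge> \<gamma>"
  shows "poly (gtsc_poly n (nat (max m 0)) (nat (max (- m) 0)) \<alpha> \<kappa> \<zeta> \<phi> \<gamma> c q) z
    = z ^ nat (max (- m) 0) * (gtsc_exponent \<alpha> \<kappa> \<zeta> \<phi> \<gamma> c (z ^ n - \<gamma>) - q)"
proof -
  have *: "z ^ nat (max m 0) = z ^ nat (max (- m) 0) * (z ^ n) powr \<alpha>"
  proof (cases "z = 0")
    case True
    then have "\<alpha> > 0" using assms by (cases "\<alpha> > 0") (auto simp: zero_less_divide_iff zero_power not_less divide_less_0_iff)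
    then show ?thesis using True \<open>n > 0\<close> by (simp add: \<alpha> zero_less_divide_iff zero_power)
  next
    case False
    then have "z > 0" using assms by simp
    then have "(z ^ n) powr \<alpha> = z powr m"
      using \<open>n > 0\<close> by (simp add: \<alpha> powr_powr flip: powr_realpow)
    then show ?thesis
      using \<open>z > 0\<close> by (cases "m \<ge> 0") (auto simp flip: powr_realpow powr_add)
  qed
  show ?thesis
    unfolding gtsc_poly_def gtsc_exponent_def
    by (simp add: poly_monom * power_add algebra_simps)
qed

lemma sgn_Gamma_minus:
  assumes "0 < \<bar>\<alpha>\<bar>" "\<bar>\<alpha>\<bar> < (1::real)"
  shows "sgn (Gamma (- \<alpha>)) = - sgn \<alpha>"
proof (cases "\<alpha> > 0")
  case True
  have "- \<alpha> \<notin> \<int>\<^sub>\<le>\<^sub>0"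
  proof
    assume "- \<alpha> \<in> \<int>\<^sub>\<le>\<^sub>0"
    then obtain k where "- \<alpha> = real_of_int k" by (auto elim: nonpos_Ints_cases)
    then have "real_of_int (- 1) < real_of_int k" "real_of_int k < real_of_int 0"
      using True assms by auto
    then show False unfolding of_int_less_iff by simp
  qed
  then have "Gamma (1 - \<alpha>) = - \<alpha> * Gamma (- \<alpha>)" using Gamma_plus1[of "- \<alpha>"] by simp
  moreover have "Gamma (1 - \<alpha>) > 0" using assms by (intro Gamma_real_pos) auto
  ultimately have "\<alpha> * Gamma (- \<alpha>) < 0" by simp
  then show ?thesis using True by (simp add: mult_less_0_iff)
next
  case False
  then show ?thesis using assms Gamma_real_pos[of "- \<alpha>"] by (auto simp: sgn_if simp del: Gamma_real_pos)
qed

text \<open>The bracket is eventually bounded below by a positive constant \<open>b\<close>, and the factor \<open>\<theta> - \<phi>\<close> tends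
  to infinity. For \<open>\<alpha> > 0\<close> the coefficient \<open>c \<Gamma>(-\<alpha>)\<close> is negative and \<open>(\<gamma> + \<theta>)\<^bsup>\<alpha>\<^esup>\<close> is unbounded; for
  \<open>\<alpha> < 0\<close> it is positive and \<open>(\<gamma> + \<theta>)\<^bsup>\<alpha>\<^esup>\<close> tends to \<open>0\<close>, so that the limit \<open>c \<Gamma>(-\<alpha>) \<gamma>\<^bsup>\<alpha>\<^esup>\<close> is positive
  because \<open>\<gamma> > 0\<close>.\<close>

lemma gtsc_exponent_at_top:
  assumes "0 < \<bar>\<alpha>\<bar>" "\<bar>\<alpha>\<bar> < 1" "\<kappa> \<ge> 0" "\<zeta> \<ge> 0" "\<gamma> \<ge> 0" "c > 0" "\<alpha> < 0 \<Longrightarrow> \<gamma> > 0"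
  shows "filterlim (gtsc_exponent \<alpha> \<kappa> \<zeta> \<phi> \<gamma> c) at_top at_top"
proof -
  define C where "C = c * Gamma (- \<alpha>)"
  have "\<exists>b>0. eventually (\<lambda>\<theta>. b \<le> C * (\<gamma> powr \<alpha> - (\<gamma> + \<theta>) powr \<alpha>)) at_top"
  proof (cases "\<alpha> > 0")
    case True
    then have "C < 0" using sgn_Gamma_minus[of \<alpha>] assms by (auto simp: C_def mult_less_0_iff sgn_if split: if_splits)
    then have "filterlim (\<lambda>\<theta>. C * (\<gamma> powr \<alpha> - (\<gamma> + \<theta>) powr \<alpha>)) at_top at_top"
      using True by real_asymp
    then have "eventually (\<lambda>\<theta>. 1 \<le> C * (\<gamma> powr \<alpha> - (\<gamma> + \<theta>) powr \<alpha>)) at_top"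
      by (simp add: filterlim_at_top)
    then show ?thesis by (intro exI[of _ 1]) simp
  next
    case False
    then have "\<alpha> < 0" using assms by auto
    then have "C > 0" using sgn_Gamma_minus[of \<alpha>] assms by (auto simp: C_def zero_less_mult_iff sgn_if split: if_splits)
    have "((\<lambda>\<theta>. C * (\<gamma> powr \<alpha> - (\<gamma> + \<theta>) powr \<alpha>)) \<longlongrightarrow> C * \<gamma> powr \<alpha>) at_top"
      using \<open>\<alpha> < 0\<close> by real_asymp
    moreover have p: "C * \<gamma> powr \<alpha> > 0" using \<open>C > 0\<close> assms(7)[OF \<open>\<alpha> < 0\<close>] by simp
    ultimately have "eventually (\<lambda>\<theta>. C * \<gamma> powr \<alpha> / 2 < C * (\<gamma> powr \<alpha> - (\<gamma> + \<theta>) powr \<alpha>)) at_top"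
      by (intro order_tendstoD(1)) auto
    then show ?thesis using p
      by (intro exI[of _ "C * \<gamma> powr \<alpha> / 2"]) (auto elim: eventually_mono)
  qed
  then obtain b where "b > 0" and b: "eventually (\<lambda>\<theta>. b \<le> C * (\<gamma> powr \<alpha> - (\<gamma> + \<theta>) powr \<alpha>)) at_top"
    by blast
  have "filterlim (\<lambda>\<theta>. (\<theta> - \<phi>) * b) at_top at_top" using \<open>b > 0\<close> by real_asymp
  moreover have "eventually (\<lambda>\<theta>. (\<theta> - \<phi>) * b \<le> gtsc_exponent \<alpha> \<kappa> \<zeta> \<phi> \<gamma> c \<theta>) at_top"
    using b eventually_ge_at_top[of "max 0 \<phi>"]
  proof eventually_elim
    case (elim \<theta>)
    then have "b \<le> \<kappa> + \<zeta> * \<theta> + C * (\<gamma> powr \<alpha> - (\<gamma> + \<theta>) powr \<alpha>)"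
      using assms by (intro order_trans[OF elim(1)]) simp
    then show ?case using elim unfolding gtsc_exponent_def C_def by (intro mult_left_mono) auto
  qed
  ultimately show ?thesis by (rule filterlim_at_top_mono)
qed

text \<open>The exponent exceeds \<open>q\<close> far out. Besides giving the upper end for the intermediate value theorem,
  this shows that the polynomial is nonzero, so that it has finitely many roots.\<close>

lemma gtsc_poly_pos:
  fixes m :: int and n :: nat
  assumes \<alpha>: "\<alpha> = real_of_int m / real n" and m: "0 < \<bar>m\<bar>" "\<bar>m\<bar> < int n"
    and "\<kappa> \<ge> 0" "\<zeta> \<ge> 0" "\<gamma> \<ge> 0" "c > 0" "\<alpha> < 0 \<Longrightarrow> \<gamma> > 0"
  obtains z where "z \<ge> root n \<gamma>"
    "poly (gtsc_poly n (nat (max m 0)) (nat (max (- m) 0)) \<alpha> \<kappa> \<zeta> \<phi> \<gamma> c q) z > 0"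
proof -
  have n: "n > 0" and a: "0 < \<bar>\<alpha>\<bar>" "\<bar>\<alpha>\<bar> < 1" using m by (auto simp: \<alpha> abs_divide)
  have "eventually (\<lambda>\<theta>. gtsc_exponent \<alpha> \<kappa> \<zeta> \<phi> \<gamma> c \<theta> > q \<and> \<theta> > 0) at_top"
    using gtsc_exponent_at_top[OF a] assms
    by (intro eventually_conj eventually_gt_at_top) (simp add: filterlim_at_top_dense)
  then obtain \<theta> where \<theta>: "gtsc_exponent \<alpha> \<kappa> \<zeta> \<phi> \<gamma> c \<theta> > q" "\<theta> > 0"
    by (auto simp: eventually_at_top_linorder)
  define z where "z = root n (\<gamma> + \<theta>)"
  have z: "z > 0" "z \<ge> root n \<gamma>" "z ^ n = \<gamma> + \<theta>" using n \<theta> \<open>\<gamma> \<ge> 0\<close> by (auto simp: z_def)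
  then have "poly (gtsc_poly n (nat (max m 0)) (nat (max (- m) 0)) \<alpha> \<kappa> \<zeta> \<phi> \<gamma> c q) z
      = z ^ nat (max (- m) 0) * (gtsc_exponent \<alpha> \<kappa> \<zeta> \<phi> \<gamma> c \<theta> - q)"
    using poly_gtsc_poly[OF \<alpha> _ n assms(8), of z] m \<theta> by simp
  then show ?thesis using that[of z] z \<theta> by simp
qed

text \<open>At \<open>\<gamma>\<^bsup>1/n\<^esup>\<close>, which corresponds to \<open>\<theta> = 0\<close>, the exponent vanishes because \<open>\<kappa>\<phi> = 0\<close>, so the
  polynomial is \<open>\<le> 0\<close> there.\<close>

lemma gtsc_poly_root_exists:
  fixes m :: int and n :: nat
  assumes \<alpha>: "\<alpha> = real_of_int m / real n" and m: "0 < \<bar>m\<bar>" "\<bar>m\<bar> < int n"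
    and "\<kappa> \<ge> 0" "\<zeta> \<ge> 0" "\<gamma> \<ge> 0" "c > 0" "\<alpha> < 0 \<Longrightarrow> \<gamma> > 0" and "\<kappa> * \<phi> = 0" "q \<ge> 0"
  obtains z where "z \<ge> root n \<gamma>"
    "poly (gtsc_poly n (nat (max m 0)) (nat (max (- m) 0)) \<alpha> \<kappa> \<zeta> \<phi> \<gamma> c q) z = 0"
proof -
  let ?f = "gtsc_poly n (nat (max m 0)) (nat (max (- m) 0)) \<alpha> \<kappa> \<zeta> \<phi> \<gamma> c q"
  have n: "n > 0" using m by auto
  have "gtsc_exponent \<alpha> \<kappa> \<zeta> \<phi> \<gamma> c 0 = 0" using \<open>\<kappa> * \<phi> = 0\<close> by (auto simp: gtsc_exponent_def)
  then have "poly ?f (root n \<gamma>) = root n \<gamma> ^ nat (max (- m) 0) * (- q)"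
    using poly_gtsc_poly[OF \<alpha> _ n assms(8), of "root n \<gamma>"] m n \<open>\<gamma> \<ge> 0\<close> by simp
  then have lo: "poly ?f (root n \<gamma>) \<le> 0"
    using \<open>\<gamma> \<ge> 0\<close> \<open>q \<ge> 0\<close> n by (simp add: real_root_ge_zero)
  obtain z1 where z1: "z1 \<ge> root n \<gamma>" "poly ?f z1 > 0"
    by (rule gtsc_poly_pos[OF assms(1-8)])
  obtain z where "root n \<gamma> \<le> z" "poly ?f z = 0"
    using IVT'[of "poly ?f", OF lo less_imp_le[OF z1(2)] z1(1) continuous_on_poly[OF continuous_on_id]]
    by blast
  then show ?thesis by (rule that)
qed

text \<open>The solutions \<open>\<theta> \<ge> 0\<close> correspond to the roots \<open>z \<ge> \<gamma>\<^bsup>1/n\<^esup>\<close> through the increasing map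
  \<open>z \<mapsto> z\<^bsup>n\<^esup> - \<gamma>\<close>. Passing from a root back to a solution divides by a power of the root, which is
  nonzero when \<open>m < 0\<close> because then \<open>\<gamma> > 0\<close>.\<close>

lemma Sup_gtsc_exponent_level:
  fixes m :: int and n :: nat
  assumes \<alpha>: "\<alpha> = real_of_int m / real n" and m: "0 < \<bar>m\<bar>" "\<bar>m\<bar> < int n"
    and "\<kappa> \<ge> 0" "\<zeta> \<ge> 0" "\<gamma> \<ge> 0" "c > 0" "\<alpha> < 0 \<Longrightarrow> \<gamma> > 0" "\<kappa> * \<phi> = 0" "q \<ge> 0"
    and f: "f = gtsc_poly n (nat (max m 0)) (nat (max (- m) 0)) \<alpha> \<kappa> \<zeta> \<phi> \<gamma> c q"
    and r: "poly f r = 0" "\<And>x. poly f x = 0 \<Longrightarrow> x \<le> r"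
  shows "Sup {\<theta>. \<theta> \<ge> 0 \<and> gtsc_exponent \<alpha> \<kappa> \<zeta> \<phi> \<gamma> c \<theta> = q} = r ^ n - \<gamma>"
proof (rule cSup_eq_maximum)
  have n: "n > 0" and m0: "m \<noteq> 0" using m by auto
  obtain z where "z \<ge> root n \<gamma>" "poly f z = 0"
    unfolding f by (rule gtsc_poly_root_exists[OF assms(1-10)])
  then have r\<gamma>: "r \<ge> root n \<gamma>" using r(2)[of z] by simp
  then have r0: "r \<ge> 0" using real_root_ge_zero[OF \<open>\<gamma> \<ge> 0\<close>, of n] by linarith
  have "root n \<gamma> ^ n \<le> r ^ n" using r\<gamma> \<open>\<gamma> \<ge> 0\<close> by (intro power_mono) (auto intro: real_root_ge_zero)
  then have r1: "r ^ n \<ge> \<gamma>" using n \<open>\<gamma> \<ge> 0\<close> by simp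
  have r_pow: "r ^ nat (max (- m) 0) \<noteq> 0"
  proof (cases "m > 0")
    case False
    then have "\<alpha> < 0" using m n by (simp add: \<alpha> divide_less_0_iff)
    then have "r \<noteq> 0" using assms(8) r1 n by (auto simp: zero_power)
    then show ?thesis by simp
  qed simp
  moreover have "r ^ nat (max (- m) 0) * (gtsc_exponent \<alpha> \<kappa> \<zeta> \<phi> \<gamma> c (r ^ n - \<gamma>) - q) = 0"
    using poly_gtsc_poly[OF \<alpha> m0 n assms(8) r0 r1] r(1) unfolding f by (rule trans[OF sym])
  ultimately have "gtsc_exponent \<alpha> \<kappa> \<zeta> \<phi> \<gamma> c (r ^ n - \<gamma>) = q"
    by (metis eq_iff_diff_eq_0 mult_eq_0_iff)
  then show "r ^ n - \<gamma> \<in> {\<theta>. \<theta> \<ge> 0 \<and> gtsc_exponent \<alpha> \<kappa> \<zeta> \<phi> \<gamma> c \<theta> = q}" using r1 by simp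
  fix \<theta> assume "\<theta> \<in> {\<theta>. \<theta> \<ge> 0 \<and> gtsc_exponent \<alpha> \<kappa> \<zeta> \<phi> \<gamma> c \<theta> = q}"
  then have \<theta>: "\<theta> \<ge> 0" "gtsc_exponent \<alpha> \<kappa> \<zeta> \<phi> \<gamma> c \<theta> = q" by auto
  define z where "z = root n (\<gamma> + \<theta>)"
  have z: "z \<ge> 0" "z ^ n = \<gamma> + \<theta>" using n \<theta> \<open>\<gamma> \<ge> 0\<close> by (auto simp: z_def)
  then have "poly f z = 0"
    using poly_gtsc_poly[OF \<alpha> _ n assms(8) z(1), of \<kappa> \<zeta> \<phi> c q] m \<theta> by (simp add: f)
  then have "z ^ n \<le> r ^ n" using r(2) z by (intro power_mono) auto
  then show "\<theta> \<le> r ^ n - \<gamma>" using z by simp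
qed

section \<open>The scale function\<close>

text \<open>For \<open>a = b\<close> the factor \<open>s\<^bsup>a-b\<^esup>\<close> disappears, so sums of Mittag-Leffler kernels transform exactly
  into partial fractions in \<open>s\<^bsup>a\<^esup>\<close>.\<close>

lemma laplace_partial_fraction:
  fixes r :: "'k \<Rightarrow> complex" and a s :: real
  assumes "a > 0" "s > 0" "\<And>k. k \<in> K \<Longrightarrow> norm (r k) < s powr a"
  shows "has_bochner_integral lborel
    (\<lambda>x. indicator {0<..} x *\<^sub>R (of_real (exp (- (s * x))) *
      (\<Sum>k\<in>K. \<Sum>j<\<mu> k. A k j * (1 / fact j) * of_real (x powr (real (j + 1) * a - 1)) *
        (deriv ^^ j) (mittag_leffler a a) (r k * of_real (x powr a)))))
    (\<Sum>k\<in>K. \<Sum>j<\<mu> k. A k j / (of_real (s powr a) - r k) ^ (j + 1))"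
proof -
  have "has_bochner_integral lborel
    (\<lambda>x. A k j * (1 / fact j) * (indicator {0<..} x *\<^sub>R (of_real (exp (- (s * x))) *
      (of_real (x powr (a * real j + a - 1)) *
        (deriv ^^ j) (mittag_leffler a a) (r k * of_real (x powr a))))))
    (A k j * (1 / fact j) *
      (fact j * of_real (s powr (a - a)) / (of_real (s powr a) - r k) ^ (j + 1)))" if "k \<in> K" for k j
    using assms that by (intro has_bochner_integral_mult_right laplace_mittag_leffler) auto
  then have "has_bochner_integral lborel
    (\<lambda>x. \<Sum>k\<in>K. \<Sum>j<\<mu> k. A k j * (1 / fact j) * (indicator {0<..} x *\<^sub>R (of_real (exp (- (s * x))) *
      (of_real (x powr (a * real j + a - 1)) *
        (deriv ^^ j) (mittag_leffler a a) (r k * of_real (x powr a))))))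
    (\<Sum>k\<in>K. \<Sum>j<\<mu> k. A k j * (1 / fact j) *
      (fact j * of_real (s powr (a - a)) / (of_real (s powr a) - r k) ^ (j + 1)))"
    by (intro has_bochner_integral_sum)
  then show ?thesis
    using \<open>s > 0\<close> by (simp add: sum_distrib_left scaleR_sum_right algebra_simps)
qed

lemma continuous_on_mittag_leffler_sum:
  assumes "a > 0"
  shows "continuous_on {0<..} (\<lambda>x::real. \<Sum>k\<in>K. \<Sum>j<\<mu> k.
      A k j * (1 / fact j) * of_real (x powr (real (j + 1) * a - 1)) *
        (deriv ^^ j) (mittag_leffler a a) (r k * of_real (x powr a)))"
proof -
  have "continuous_on UNIV ((deriv ^^ j) (mittag_leffler a a))" for j
    using isCont_higher_deriv_mittag_leffler[OF assms assms]
    by (simp add: continuous_on_eq_continuous_at)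
  then have "continuous_on {0<..}
      (\<lambda>x::real. (deriv ^^ j) (mittag_leffler a a) (r k * of_real (x powr a)))" for j k
    by (rule continuous_on_compose2) (auto intro!: continuous_intros)
  then show ?thesis
    by (intro continuous_on_sum continuous_on_mult continuous_on_const continuous_on_of_real)
      (auto intro!: continuous_intros)
qed

lemma poly_map_poly_of_real:
  "poly (map_poly of_real p) (of_real x) = (of_real (poly p x) :: complex)"
  by (induction p) (simp_all add: map_poly_pCons)

theorem theorem6p1:
  fixes m :: int and n :: nat and \<alpha> \<kappa> \<zeta> \<phi> \<gamma> c q :: real
    and M :: "'a measure" and X :: "real \<Rightarrow> 'a \<Rightarrow> real"
    and \<psi> :: "complex \<Rightarrow> complex" and W :: "real \<Rightarrow> real"
    and mp mm :: nat and f :: "real poly" and F :: "complex poly"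
  assumes "\<alpha> = real_of_int m / real n"
    and "0 < \<bar>m\<bar>" and "\<bar>m\<bar> < int n" and "gcd \<bar>m\<bar> (int n) = 1"
    and "\<kappa> \<ge> 0" and "\<zeta> \<ge> 0" and "\<phi> \<ge> 0" and "\<gamma> \<ge> 0" and "c > 0"
    and "\<kappa> * \<phi> = 0" and "\<alpha> < 0 \<Longrightarrow> \<gamma> > 0"
    and "spectrally_negative_levy M X" and "has_laplace_exponent M X \<psi>"
    and "\<And>\<theta>. Re \<theta> \<ge> 0 \<Longrightarrow>
      \<psi> \<theta> = (\<theta> - of_real \<phi>) *
        (of_real \<kappa> + of_real \<zeta> * \<theta> +
         of_real (c * Gamma (- \<alpha>)) * (of_real (\<gamma> powr \<alpha>) - (of_real \<gamma> + \<theta>) powr (of_real \<alpha>)))"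
    and "q \<ge> 0" and "is_scale_function \<psi> q W"
    and "mp = nat (max m 0)" and "mm = nat (max (- m) 0)"
    and "f = (monom 1 n - [:\<gamma>:] - [:\<phi>:]) *
           (monom (\<kappa> - \<zeta> * \<gamma> + c * Gamma (- \<alpha>) * \<gamma> powr \<alpha>) mm + monom \<zeta> (n + mm)
            - monom (c * Gamma (- \<alpha>)) mp)
           - monom q mm"
    and "F = map_poly complex_of_real f"
  shows "(\<exists>x::real. poly f x = 0) \<and>
    (\<forall>(l::nat) (r :: nat \<Rightarrow> complex) (\<mu> :: nat \<Rightarrow> nat) (A :: nat \<Rightarrow> nat \<Rightarrow> complex).
       l = card {z. poly F z = 0} \<longrightarrow>
       bij_betw r {1..l} {z. poly F z = 0} \<longrightarrow>
       r 1 \<in> \<real> \<longrightarrow> (\<forall>x::real. poly f x = 0 \<longrightarrow> x \<le> Re (r 1)) \<longrightarrow>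
       (\<forall>k\<in>{1..l}. \<mu> k = order (r k) F) \<longrightarrow>
       (\<forall>z. poly F z \<noteq> 0 \<longrightarrow>
          z ^ mm / poly F z = (\<Sum>k=1..l. \<Sum>j<\<mu> k. A k j / (z - r k) ^ (j + 1))) \<longrightarrow>
       complex_of_real (Phi \<psi> q) = r 1 ^ n - of_real \<gamma> \<and>
       (\<forall>x>0. complex_of_real (W x) =
          of_real (exp (- \<gamma> * x)) *
          (\<Sum>k=1..l. \<Sum>j<\<mu> k.
             A k j * (1 / fact j) * of_real (x powr (real (j + 1) / real n - 1)) *
             (deriv ^^ j) (mittag_leffler (1 / real n) (1 / real n))
               (r k * of_real (x powr (1 / real n))))))"
proof -
  define \<psi>r where "\<psi>r = gtsc_exponent \<alpha> \<kappa> \<zeta> \<phi> \<gamma> c"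
  have m: "0 < \<bar>m\<bar>" "\<bar>m\<bar> < int n" "m \<noteq> 0" and n: "n > 0" using assms(2,3) by auto
  note params = assms(1-3,5,6,8,9,11)
  have f: "f = gtsc_poly n (nat (max m 0)) (nat (max (- m) 0)) \<alpha> \<kappa> \<zeta> \<phi> \<gamma> c q"
    using assms(17-19) by (simp add: gtsc_poly_def)
  have \<psi>: "\<psi> (of_real \<theta>) = of_real (\<psi>r \<theta>)" if "\<theta> \<ge> 0" for \<theta>
  proof -
    have "(complex_of_real \<gamma> + of_real \<theta>) powr of_real \<alpha> = of_real ((\<gamma> + \<theta>) powr \<alpha>)"
      using that \<open>\<gamma> \<ge> 0\<close> by (subst of_real_add [symmetric], subst powr_of_real) auto
    then show ?thesis using assms(14)[of "of_real \<theta>"] that by (simp add: \<psi>r_def gtsc_exponent_def)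
  qed
  obtain z0 where z0: "poly f z0 = 0"
    unfolding f by (rule gtsc_poly_root_exists[OF params assms(10,15)])
  obtain z1 where "poly f z1 > 0"
    unfolding f by (rule gtsc_poly_pos[OF params])
  then have "poly F (of_real z1) \<noteq> 0" unfolding assms(20) poly_map_poly_of_real by simp
  then have fin: "finite {z. poly F z = 0}" by (intro poly_roots_finite) auto
  have F_real: "poly F (of_real x) = of_real (poly f x)" for x
    unfolding assms(20) by (rule poly_map_poly_of_real)
  have Phi_eq: "Phi \<psi> q = \<rho> ^ n - \<gamma>" if "poly f \<rho> = 0" "\<And>x. poly f x = 0 \<Longrightarrow> x \<le> \<rho>" for \<rho>
  proof -
    have "{\<theta>. \<theta> \<ge> 0 \<and> \<psi> (complex_of_real \<theta>) = complex_of_real q} = {\<theta>. \<theta> \<ge> 0 \<and> \<psi>r \<theta> = q}"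
      by (auto simp: \<psi>)
    then show ?thesis
      using Sup_gtsc_exponent_level[OF params assms(10,15) f that] by (simp add: Phi_def \<psi>r_def)
  qed
  have W_eq: "complex_of_real (W x) =
          of_real (exp (- \<gamma> * x)) *
          (\<Sum>k=1..l. \<Sum>j<\<mu> k.
             A k j * (1 / fact j) * of_real (x powr (real (j + 1) / real n - 1)) *
             (deriv ^^ j) (mittag_leffler (1 / real n) (1 / real n))
               (r k * of_real (x powr (1 / real n))))"
    if r: "{z. poly F z = 0} = r ` {1..l}"
      and pf: "\<And>z. poly F z \<noteq> 0 \<Longrightarrow>
          z ^ mm / poly F z = (\<Sum>k=1..l. \<Sum>j<\<mu> k. A k j / (z - r k) ^ (j + 1))"
      and "x > 0"
    for l :: nat and r :: "nat \<Rightarrow> complex" and \<mu> :: "nat \<Rightarrow> nat" and A :: "nat \<Rightarrow> nat \<Rightarrow> complex" and x :: real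
  proof -
    define a where "a = 1 / real n"
    have "a > 0" using n by (simp add: a_def)
    define S :: "real \<Rightarrow> complex" where "S = (\<lambda>x. \<Sum>k=1..l. \<Sum>j<\<mu> k.
             A k j * (1 / fact j) * of_real (x powr (real (j + 1) * a - 1)) *
             (deriv ^^ j) (mittag_leffler a a) (r k * of_real (x powr a)))"
    \<comment> \<open>Beyond \<open>\<sigma>\<close>, the transform of \<open>W\<close> exists and \<open>(\<theta> + \<gamma>)\<^bsup>1/n\<^esup>\<close> exceeds the modulus of every root.\<close>
    define R where "R = 1 + (\<Sum>k=1..l. norm (r k))"
    define \<sigma> where "\<sigma> = max (Phi \<psi> q) (R ^ n)"
    have R: "R \<ge> 1" by (simp add: R_def sum_nonneg)
    have rR: "norm (r k) < R" if "k \<in> {1..l}" for k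
      using member_le_sum[of k "{1..l}" "\<lambda>k. norm (r k)"] that by (simp add: R_def)
    have large: "\<theta> > 0 \<and> (\<theta> + \<gamma>) powr a > R" if "\<theta> > \<sigma>" for \<theta>
    proof -
      have "\<theta> > R ^ n" using that by (simp add: \<sigma>_def)
      moreover have "R ^ n \<ge> 1" using R by simp
      ultimately have "\<theta> > 0" "\<theta> + \<gamma> > R ^ n" using \<open>\<gamma> \<ge> 0\<close> by linarith+
      moreover from this have "root n (R ^ n) < root n (\<theta> + \<gamma>)" using n by simp
      moreover have "root n (R ^ n) = R" using R n by (simp add: real_root_power_cancel)
      ultimately show ?thesis
        using n \<open>\<gamma> \<ge> 0\<close> root_powr_inverse[of n "\<theta> + \<gamma>"] by (simp add: a_def)
    qed
    have "complex_of_real (W x) = of_real (exp (- \<gamma> * x)) * S x"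
    proof (rule laplace_unique[where \<sigma> = \<sigma> and L = "\<lambda>s. 1 / (\<psi> (of_real s) - of_real q)"])
      show "continuous_on {0<..} (\<lambda>x. complex_of_real (W x))"
        using assms(16) unfolding is_scale_function_def
        by (intro continuous_intros) (auto elim: continuous_on_subset)
      show "continuous_on {0<..} (\<lambda>x. of_real (exp (- \<gamma> * x)) * S x)"
        unfolding S_def by (intro continuous_on_mult continuous_on_mittag_leffler_sum \<open>a > 0\<close>)
          (intro continuous_intros)
    next
      fix \<theta> assume "\<theta> > \<sigma>"
      then have "Re (of_real \<theta>) > Phi \<psi> q" by (simp add: \<sigma>_def)
      then have W: "has_bochner_integral lborel (\<lambda>x. indicator {0..} x *\<^sub>R
            (exp (- complex_of_real \<theta> * complex_of_real x) * complex_of_real (W x)))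
          (1 / (\<psi> (of_real \<theta>) - of_real q))"
        using assms(16) unfolding is_scale_function_def set_integrable_def
          set_lebesgue_integral_def has_bochner_integral_iff by blast
      then have "(\<lambda>x. indicator {0<..} x *\<^sub>R (indicator {0..} x *\<^sub>R
          (exp (- complex_of_real \<theta> * complex_of_real x) * complex_of_real (W x))))
          \<in> borel_measurable lborel"
        by (intro borel_measurable_scaleR borel_measurable_indicator borel_measurable_has_bochner_integral) auto
      also have "(\<lambda>x. indicator {0<..} x *\<^sub>R (indicator {0..} x *\<^sub>R
          (exp (- complex_of_real \<theta> * complex_of_real x) * complex_of_real (W x))))
          = (\<lambda>x. indicator {0<..} x *\<^sub>R (of_real (exp (- (\<theta> * x))) * complex_of_real (W x)))"
        by (auto simp: fun_eq_iff indicator_def simp flip: exp_of_real)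
      \<comment> \<open>The transform of \<open>W\<close> is over \<open>[0, \<infinity>)\<close>; dropping the point \<open>0\<close> does not change it.\<close>
      finally show "has_bochner_integral lborel (\<lambda>x. indicator {0<..} x *\<^sub>R
          (of_real (exp (- (\<theta> * x))) * complex_of_real (W x))) (1 / (\<psi> (of_real \<theta>) - of_real q))"
        by (rule has_bochner_integralI_AE[OF W])
          (auto intro!: eventually_mono[OF AE_lborel_singleton[of 0]] simp: indicator_def simp flip: exp_of_real)
    next
      fix \<theta> assume "\<theta> > \<sigma>"
      then have \<theta>: "\<theta> > 0" "(\<theta> + \<gamma>) powr a > R" using large by auto
      define p where "p = (\<theta> + \<gamma>) powr a"
      have p: "p > R" "p > 0" using \<theta> R by (auto simp: p_def)
      have pn: "p ^ n = \<theta> + \<gamma>"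
        using \<open>\<theta> > 0\<close> \<open>\<gamma> \<ge> 0\<close> n by (simp add: p_def a_def powr_powr flip: powr_realpow')
      have fp: "poly f p = p ^ mm * (\<psi>r \<theta> - q)"
        using poly_gtsc_poly[OF assms(1) m(3) n assms(11), of p \<kappa> \<zeta> \<phi> c q] p pn \<open>\<theta> > 0\<close>
        by (simp add: f assms(18) \<psi>r_def)
      have "poly F (of_real p) \<noteq> 0"
      proof
        assume "poly F (of_real p) = 0"
        then have "of_real p \<in> r ` {1..l}" using r by blast
        then obtain k where "k \<in> {1..l}" "r k = of_real p" by auto
        then show False using rR[of k] p by simp
      qed
      then have "(\<Sum>k=1..l. \<Sum>j<\<mu> k. A k j / (of_real p - r k) ^ (j + 1)) = of_real p ^ mm / poly F (of_real p)"
        using pf by simp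
      also have "\<dots> = 1 / (\<psi> (of_real \<theta>) - of_real q)"
        using \<theta> p by (simp add: F_real fp \<psi>)
      finally have val: "(\<Sum>k=1..l. \<Sum>j<\<mu> k. A k j / (of_real p - r k) ^ (j + 1))
          = 1 / (\<psi> (of_real \<theta>) - of_real q)" .
      have "has_bochner_integral lborel (\<lambda>x. indicator {0<..} x *\<^sub>R
          (of_real (exp (- ((\<theta> + \<gamma>) * x))) * S x))
          (\<Sum>k=1..l. \<Sum>j<\<mu> k. A k j / (of_real p - r k) ^ (j + 1))"
        unfolding S_def p_def
      proof (rule laplace_partial_fraction)
        show "norm (r k) < (\<theta> + \<gamma>) powr a" if "k \<in> {1..l}" for k
          using rR[OF that] \<theta> by linarith
      qed (use \<open>a > 0\<close> \<theta> \<open>\<gamma> \<ge> 0\<close> in auto)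
      \<comment> \<open>The shift of the transform variable by \<open>\<gamma>\<close> becomes the factor \<open>e\<^bsup>-\<gamma>x\<^esup>\<close>.\<close>
      moreover have "of_real (exp (- ((\<theta> + \<gamma>) * x)))
          = of_real (exp (- (\<theta> * x))) * (of_real (exp (- \<gamma> * x)) :: complex)" for x
        by (simp add: algebra_simps flip: exp_add of_real_mult)
      ultimately show "has_bochner_integral lborel (\<lambda>x. indicator {0<..} x *\<^sub>R
          (of_real (exp (- (\<theta> * x))) * (of_real (exp (- \<gamma> * x)) * S x)))
          (1 / (\<psi> (of_real \<theta>) - of_real q))"
        unfolding val by (simp add: mult.assoc)
    qed (rule \<open>x > 0\<close>)
    then show ?thesis by (simp add: S_def a_def)
  qed
  show ?thesis
  proof (intro conjI exI[of _ z0] z0 allI impI)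
    fix l :: nat and r :: "nat \<Rightarrow> complex" and \<mu> :: "nat \<Rightarrow> nat" and A :: "nat \<Rightarrow> nat \<Rightarrow> complex"
    assume l: "l = card {z. poly F z = 0}" and r: "bij_betw r {1..l} {z. poly F z = 0}"
      and r1: "r 1 \<in> \<real>" and max: "\<forall>x::real. poly f x = 0 \<longrightarrow> x \<le> Re (r 1)"
      and pf: "\<forall>z. poly F z \<noteq> 0 \<longrightarrow>
          z ^ mm / poly F z = (\<Sum>k=1..l. \<Sum>j<\<mu> k. A k j / (z - r k) ^ (j + 1))"
    have img: "{z. poly F z = 0} = r ` {1..l}" using r by (simp add: bij_betw_def)
    have "of_real z0 \<in> {z. poly F z = 0}" using z0 by (simp add: F_real)
    then have "l \<noteq> 0" using fin by (auto simp: l)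
    then have "poly F (r 1) = 0" using img by auto
    moreover from r1 obtain \<rho> where \<rho>: "r 1 = of_real \<rho>" by (auto elim: Reals_cases)
    ultimately have "poly f \<rho> = 0" by (simp add: F_real)
    then have "Phi \<psi> q = \<rho> ^ n - \<gamma>" using max[unfolded \<rho>] by (intro Phi_eq) simp_all
    then show "complex_of_real (Phi \<psi> q) = r 1 ^ n - of_real \<gamma>" unfolding \<rho> by simp
    fix x :: real assume x: "x > 0"
    show "complex_of_real (W x) =
          of_real (exp (- \<gamma> * x)) *
          (\<Sum>k=1..l. \<Sum>j<\<mu> k.
             A k j * (1 / fact j) * of_real (x powr (real (j + 1) / real n - 1)) *
             (deriv ^^ j) (mittag_leffler (1 / real n) (1 / real n))
               (r k * of_real (x powr (1 / real n))))"
      using W_eq[where l = l and r = r and \<mu> = \<mu> and A = A, OF img _ x] pf by blast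
  qed
qed

end
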